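(* For all integers $m\ge 3$ and $n\ge 2m-4$, we have $RS_{2,m}(n)=2$.
   Context: For $m\ge 3$, $E_m$ denotes the equation $x_1+x_2+\cdots+x_{m-1}=x_m$. For a positive integer $n$, $[1,n]=\{1,2,\ldots,n\}$. An $r$-coloring of a set $S$ is a map $S\to\{1,\ldots,r\}$; it is exact if it is surjective. A solution to $E_m$ in $[1,n]$ is a tuple $(x_1,\ldots,x_m)$ of (not necessarily distinct) elements of $[1,n]$ satisfying $E_m$. For $m\ge 3$ and $2\le t\le m$, the weakened rainbow Schur number $RS_{t,m}(n)$ is the minimum positive integer $r$ such that every exact $r$-coloring of $[1,n]$ admits a solution $(x_1,\ldots,x_m)$ to $E_m$ in $[1,n]$ whose entries $x_1,\ldots,x_m$ receive at least $t$ distinct colors. *)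

theory Defs
  imports Main
begin

definition coloring :: "nat \<Rightarrow> nat set \<Rightarrow> (nat \<Rightarrow> nat) \<Rightarrow> bool" where
  "coloring r S c \<longleftrightarrow> (\<forall>s\<in>S. c s \<in> {1..r})"

definition exact_coloring :: "nat \<Rightarrow> nat set \<Rightarrow> (nat \<Rightarrow> nat) \<Rightarrow> bool" where
  "exact_coloring r S c \<longleftrightarrow> coloring r S c \<and> c ` S = {1..r}"

(* The tuple (x_1, ..., x_m) is a function on indices; only its values on {1..m} matter. *)
definition Em_solution :: "nat \<Rightarrow> nat \<Rightarrow> (nat \<Rightarrow> nat) \<Rightarrow> bool" where
  "Em_solution m n x \<longleftrightarrow> (\<forall>i\<in>{1..m}. x i \<in> {1..n}) \<and> (\<Sum>i=1..m-1. x i) = x m"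

definition forces_colors :: "nat \<Rightarrow> nat \<Rightarrow> nat \<Rightarrow> nat \<Rightarrow> bool" where
  "forces_colors t m n r \<longleftrightarrow>
     (\<forall>c. exact_coloring r {1..n} c \<longrightarrow>
        (\<exists>x. Em_solution m n x \<and> t \<le> card ((\<lambda>i. c (x i)) ` {1..m})))"

(* Intended for m >= 3 and 2 <= t <= m.  The minimum always exists: for r > n there is no exact
   r-coloring of {1..n}, so forces_colors holds vacuously. *)
definition RS :: "nat \<Rightarrow> nat \<Rightarrow> nat \<Rightarrow> nat" where
  "RS t m n = (LEAST r. 0 < r \<and> forces_colors t m n r)"

end

(* Every v in {1..n} lies in a solution that also contains 1: take m - 2 ones and k with
   sum m - 2 + k, where k = v if v \<le> m - 2 (the sum is then at most 2m - 4 \<le> n), and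
   k = v - (m - 2) otherwise. In an exact 2-coloring some v differs in color from 1. *)
theory Submission imports Defs begin

text \<open>The entry \<open>k\<close> sits at index 1, so the indices 2 to \<open>m - 1\<close>
  hold the \<open>m - 2\<close> ones. The largest entry is the sum at index \<open>m\<close>, so
  bounding it by \<open>n\<close> suffices.\<close>

lemma Em_solution_ones:
  assumes "m \<ge> 3" "1 \<le> k" "m - 2 + k \<le> n"
  shows "Em_solution m n (\<lambda>i. if i = 1 then k else if i = m then m - 2 + k else 1)"
    (is "Em_solution m n ?x")
proof -
  \<comment> \<open>Writing 2 as \<open>Suc 1\<close> gives the form in which the rule splits off
    the first term.\<close>
  have "(\<Sum>i=1..m-1. ?x i) = ?x 1 + (\<Sum>i=2..m-1. ?x i)"
    using assms sum.atLeast_Suc_atMost[of 1 "m - 1" ?x] by (simp only: one_add_one[symmetric] plus_1_eq_Suc)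
  also have "(\<Sum>i=2..m-1. ?x i) = (\<Sum>i=2..m-1. 1)"
    using assms by (intro sum.cong) auto
  finally have "(\<Sum>i=1..m-1. ?x i) = ?x m"
    using assms by simp
  moreover have "\<forall>i\<in>{1..m}. ?x i \<in> {1..n}"
    using assms by (intro ballI) (simp, linarith)
  ultimately show ?thesis
    unfolding Em_solution_def by blast
qed

lemma Em_solution_one_and:
  assumes "m \<ge> 3" "n \<ge> 2 * m - 4" "v \<in> {1..n}"
  obtains x i j where "Em_solution m n x" "i \<in> {1..m}" "j \<in> {1..m}" "x i = 1" "x j = v"
proof (cases "v \<le> m - 2")
  case True
  \<comment> \<open>Index 2 holds a one because 2 < \<open>m\<close>; \<open>v\<close> itself is the
    entry at index 1.\<close>
  show thesis
    by (rule that[OF Em_solution_ones[of m v n], of 2 1]) (use assms True in auto)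
next
  case False
  \<comment> \<open>Now \<open>v\<close> is the sum at index \<open>m\<close>; the failed case
    condition gives \<open>v - (m - 2)\<close> \<ge> 1.\<close>
  show thesis
    by (rule that[OF Em_solution_ones[of m "v - (m - 2)" n], of 2 m]) (use assms False in auto)
qed

lemma forces_colors_two:
  assumes "m \<ge> 3" "n \<ge> 2 * m - 4"
  shows "forces_colors 2 m n 2"
  unfolding forces_colors_def
proof (intro allI impI)
  fix c assume "exact_coloring 2 {1..n} c"
  then have c: "c ` {1..n} = {1..2}"
    by (simp add: exact_coloring_def)
  have "\<exists>v\<in>{1..n}. c v \<noteq> c 1"
  proof (rule ccontr)
    assume "\<not> ?thesis"
    then have "c ` {1..n} \<subseteq> {c 1}" by blast
    then have "card {1..2::nat} \<le> card {c 1}"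
      unfolding c by (intro card_mono) auto
    then show False by simp
  qed
  then obtain v where v: "v \<in> {1..n}" "c v \<noteq> c 1" by blast
  obtain x i j where x: "Em_solution m n x" "i \<in> {1..m}" "j \<in> {1..m}" "x i = 1" "x j = v"
    using Em_solution_one_and[OF assms v(1)] .
  \<comment> \<open>The two positions \<open>i\<close> and \<open>j\<close> alone already contribute
    two colors.\<close>
  have "{c 1, c v} = (\<lambda>i. c (x i)) ` {i, j}"
    using x(4,5) by simp
  also have "\<dots> \<subseteq> (\<lambda>i. c (x i)) ` {1..m}"
    using x(2,3) by (intro image_mono) simp
  finally have "card {c 1, c v} \<le> card ((\<lambda>i. c (x i)) ` {1..m})"
    by (intro card_mono) auto
  then show "\<exists>x. Em_solution m n x \<and> 2 \<le> card ((\<lambda>i. c (x i)) ` {1..m})"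
    using x(1) v(2) by auto
qed

text \<open>The constant coloring is exact because \<open>{1..n}\<close> is nonempty, and it shows
  at most one color on any tuple.\<close>

lemma not_forces_colors_one:
  assumes "n \<ge> 1" "t \<ge> 2"
  shows "\<not> forces_colors t m n 1"
proof
  assume "forces_colors t m n 1"
  moreover have "exact_coloring 1 {1..n} (\<lambda>_. 1)"
    using assms by (auto simp: exact_coloring_def coloring_def)
  ultimately have "t \<le> card ((\<lambda>i. 1::nat) ` {1..m})"
    unfolding forces_colors_def by blast
  also have "\<dots> \<le> card {1::nat}"
    by (intro card_mono) auto
  finally show False using assms by simp
qed

theorem theorem6:
  fixes m n :: nat
  assumes "m \<ge> 3" and "n \<ge> 2 * m - 4"
  shows "RS 2 m n = 2"
  unfolding RS_def
proof (rule Least_equality)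
  show "0 < (2::nat) \<and> forces_colors 2 m n 2"
    using forces_colors_two[OF assms] by simp
next
  fix r assume r: "0 < r \<and> forces_colors 2 m n r"
  \<comment> \<open>From \<open>m\<close> \<ge> 3 one gets \<open>2 * m - 4\<close> \<ge> 2, so the
    interval is nonempty.\<close>
  moreover have "n \<ge> 1"
    using assms by simp
  ultimately have "r \<noteq> 1"
    using not_forces_colors_one[of n 2 m] by auto
  with r show "2 \<le> r" by simp
qed

end
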